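(* Let $\mathbb{K}=\mathbb{R}$ or $\mathbb{K}=\mathbb{C}$, let $(X,\|\cdot\|)$ be a normed linear space over $\mathbb{K}$, let $n\ge 1$ be an integer, $(\alpha_1,\dots,\alpha_n)\in\mathbb{K}^n$, $(p_1,\dots,p_n)\in\mathbb{R}_+^n$ with $\sum_{i=1}^n p_i=1$, and $(x_1,\dots,x_n)\in X^n$. If there are $\alpha\in\mathbb{K}$ and $R>0$ such that $|\alpha_i-\alpha|\le R$ for every $i\in\{1,\dots,n\}$, then $$\left\|\sum_{i=1}^n p_i\alpha_i x_i-\sum_{i=1}^n p_i\alpha_i\cdot\sum_{i=1}^n p_i x_i\right\|\le R\sum_{i=1}^n p_i\left\|x_i-\sum_{j=1}^n p_j x_j\right\|.$$ Moreover, the constant $1$ on the right-hand side is sharp: if $C>0$ is a constant such that the inequality with $R$ replaced by $CR$ on the right-hand side holds for all normed linear spaces $X$ over $\mathbb{K}$, all integers $n\ge 1$, all $(\alpha_1,\dots,\alpha_n)\in\mathbb{K}^n$, all $(p_1,\dots,p_n)\in\mathbb{R}_+^n$ with $\sum_{i=1}^n p_i=1$, all $(x_1,\dots,x_n)\in X^n$, and all $\alpha\in\mathbb{K}$ and $R>0$ with $|\alpha_i-\alpha|\le R$ for every $i\in\{1,\dots,n\}$, then $C\ge 1$.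
   Context: $\mathbb{R}_+$ denotes the set of nonnegative real numbers. *)

theory Defs
  imports Complex_Main "HOL-Algebra.Module"
begin

text \<open>
  The scalar field is a subset \<open>K\<close> of the complex numbers with the inherited operations, so that
  \<open>K = \<real>\<close> and \<open>K = UNIV\<close> are the two cases of real and complex scalars, and \<open>cmod\<close> is the modulus
  in both of them.
\<close>

definition scalar_field :: "complex set \<Rightarrow> complex ring" where
  "scalar_field K = \<lparr>carrier = K, mult = (*), one = 1, zero = 0, add = (+)\<rparr>"

text \<open>
  Normed spaces are carrier-based, which makes it possible to quantify over all normed spaces
  inside a formula: those with carrier in the type \<open>'u\<close>, which serves as the universe. A universe
  into which the complex numbers do not inject may contain no space but the zero space, where every
  constant is admissible; hence the size condition on \<open>'u\<close> for sharpness. The components \<open>mult\<close> and \<open>one\<close> of the record \<open>M\<close> play no role.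
\<close>

locale normed_linear_space =
  F?: field "scalar_field K" + V?: module "scalar_field K" M
  for K :: "complex set" and M :: "(complex, 'u) module" (structure) +
  fixes nrm :: "'u \<Rightarrow> real"
  assumes nrm_nonneg: "x \<in> carrier M \<Longrightarrow> 0 \<le> nrm x"
    and nrm_eq_zero_iff: "x \<in> carrier M \<Longrightarrow> nrm x = 0 \<longleftrightarrow> x = \<zero>\<^bsub>M\<^esub>"
    and nrm_smult: "c \<in> K \<Longrightarrow> x \<in> carrier M \<Longrightarrow> nrm (c \<odot>\<^bsub>M\<^esub> x) = cmod c * nrm x"
    and nrm_triangle: "x \<in> carrier M \<Longrightarrow> y \<in> carrier M \<Longrightarrow> nrm (x \<oplus>\<^bsub>M\<^esub> y) \<le> nrm x + nrm y"

lemma field_scalar_field: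
  assumes "K = \<real> \<or> K = UNIV"
  shows "field (scalar_field K)"
proof -
  have inv: "inverse x \<in> K" if "x \<in> K" for x
    using assms that by auto
  have "cring (scalar_field K)"
  proof (rule cringI)
    show "abelian_group (scalar_field K)"
      using assms by (intro abelian_groupI)
        (auto simp: scalar_field_def algebra_simps add_eq_0_iff)
    show "Group.comm_monoid (scalar_field K)"
      using assms by (intro comm_monoidI) (auto simp: scalar_field_def)
  qed (auto simp: scalar_field_def algebra_simps)
  then show ?thesis
  proof (rule cring.cring_fieldI2)
    fix a assume "a \<in> carrier (scalar_field K)" "a \<noteq> \<zero>\<^bsub>scalar_field K\<^esub>"
    then show "\<exists>b\<in>carrier (scalar_field K). a \<otimes>\<^bsub>scalar_field K\<^esub> b = \<one>\<^bsub>scalar_field K\<^esub>"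
      using inv by (auto simp: scalar_field_def intro!: bexI[of _ "inverse a"])
  qed (simp add: scalar_field_def)
qed

end

theory Submission
  imports Defs
begin

text \<open>
  With \<open>s = \<Sum> p\<^sub>i x\<^sub>i\<close> the left-hand side is the norm of \<open>\<Sum> p\<^sub>i (\<alpha>\<^sub>i - \<alpha>) (x\<^sub>i - s)\<close>, because
  \<open>\<Sum> p\<^sub>i (x\<^sub>i - s) = 0\<close> allows subtracting the constant \<open>\<alpha>\<close>; the triangle inequality gives the
  bound. Equality holds in the one-dimensional space for \<open>n = 2\<close>, equal weights, and
  \<open>\<alpha>\<^sub>i = x\<^sub>i = \<plusminus>1\<close>.
\<close>

section \<open>Scalar and vector arithmetic over \<open>K\<close>\<close>

context normed_linear_space
begin

lemma scalar_field_simps [simp]: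
  "carrier (scalar_field K) = K"
  "\<zero>\<^bsub>scalar_field K\<^esub> = 0"
  "\<one>\<^bsub>scalar_field K\<^esub> = 1"
  "c \<oplus>\<^bsub>scalar_field K\<^esub> d = c + d"
  "c \<otimes>\<^bsub>scalar_field K\<^esub> d = c * d"
  by (simp_all add: scalar_field_def)

lemma zero_scalar [simp]: "0 \<in> K"
  using F.zero_closed by simp

lemma add_scalar [simp]: "c \<in> K \<Longrightarrow> d \<in> K \<Longrightarrow> c + d \<in> K"
  using F.add.m_closed[of c d] by simp

lemma mult_scalar [simp]: "c \<in> K \<Longrightarrow> d \<in> K \<Longrightarrow> c * d \<in> K"
  using F.m_closed[of c d] by simp

text \<open>Negation is not a component of the record, only an abstract inverse
  \<open>\<ominus>\<close>. Uniqueness of additive inverses in the complex numbers identifies the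
  two, so closure under \<open>\<ominus>\<close> transfers to \<open>- c\<close>.\<close>

lemma uminus_scalar [simp]:
  assumes "c \<in> K"
  shows "- c \<in> K"
proof -
  have "c + (\<ominus>\<^bsub>scalar_field K\<^esub> c) = 0"
    using F.r_neg[of c] assms by simp
  then have "\<ominus>\<^bsub>scalar_field K\<^esub> c = - c"
    by (simp add: add_eq_0_iff)
  then show ?thesis
    using F.a_inv_closed[of c] assms by simp
qed

lemma diff_scalar [simp]: "c \<in> K \<Longrightarrow> d \<in> K \<Longrightarrow> c - d \<in> K"
  using add_scalar[of c "- d"] by simp

lemma sum_scalar [simp]: "(\<And>i. i \<in> A \<Longrightarrow> c i \<in> K) \<Longrightarrow> (\<Sum>i\<in>A. c i) \<in> K"
  by (induction A rule: infinite_finite_induct) auto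

lemma smult_add_scalar:
  "c \<in> K \<Longrightarrow> d \<in> K \<Longrightarrow> v \<in> carrier M \<Longrightarrow> (c + d) \<odot> v = c \<odot> v \<oplus> d \<odot> v"
  using smult_l_distr[of c d v] by simp

lemma smult_mult_scalar:
  "c \<in> K \<Longrightarrow> d \<in> K \<Longrightarrow> v \<in> carrier M \<Longrightarrow> (c * d) \<odot> v = c \<odot> (d \<odot> v)"
  using smult_assoc1[of c d v] by simp

lemma smult_add_vector:
  "c \<in> K \<Longrightarrow> v \<in> carrier M \<Longrightarrow> w \<in> carrier M \<Longrightarrow> c \<odot> (v \<oplus> w) = c \<odot> v \<oplus> c \<odot> w"
  using smult_r_distr[of c v w] by simp

lemma smult_zero_scalar [simp]: "v \<in> carrier M \<Longrightarrow> 0 \<odot> v = \<zero>"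
  using smult_l_null[of v] by simp

lemma smult_uminus_scalar:
  assumes "c \<in> K" "v \<in> carrier M"
  shows "(- c) \<odot> v = \<ominus> (c \<odot> v)"
proof -
  have "(- c) \<odot> v \<oplus> c \<odot> v = \<zero>"
    using smult_add_scalar[of "- c" c v] assms by simp
  then show ?thesis
    using assms by (intro M.minus_equality[symmetric]) auto
qed

lemma smult_diff_scalar:
  "c \<in> K \<Longrightarrow> d \<in> K \<Longrightarrow> v \<in> carrier M \<Longrightarrow> (c - d) \<odot> v = c \<odot> v \<ominus> d \<odot> v"
  using smult_add_scalar[of c "- d" v] by (simp add: smult_uminus_scalar M.minus_eq)

lemma smult_diff_vector:
  "c \<in> K \<Longrightarrow> v \<in> carrier M \<Longrightarrow> w \<in> carrier M \<Longrightarrow> c \<odot> (v \<ominus> w) = c \<odot> v \<ominus> c \<odot> w"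
  using smult_r_minus[of c w] by (simp add: smult_add_vector M.minus_eq)

section \<open>Finite sums of vectors\<close>

lemma finsum_diff:
  assumes "finite A" "f \<in> A \<rightarrow> carrier M" "g \<in> A \<rightarrow> carrier M"
  shows "(\<Oplus>i\<in>A. f i \<ominus> g i) = (\<Oplus>i\<in>A. f i) \<ominus> (\<Oplus>i\<in>A. g i)"
  using assms
proof (induction A rule: finite_induct)
  case empty
  show ?case
    unfolding M.finsum_empty M.minus_eq by (rule M.r_neg[symmetric]) simp
next
  case (insert j A)
  then have "f j \<in> carrier M" "g j \<in> carrier M" "f \<in> A \<rightarrow> carrier M" "g \<in> A \<rightarrow> carrier M"
    by auto
  moreover from this have "(\<lambda>i. f i \<ominus> g i) \<in> A \<rightarrow> carrier M"
    by auto
  ultimately show ?case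
    using insert by (simp add: M.minus_eq M.minus_add M.a_ac)
qed

text \<open>Counterpart of \<open>finsum_smult_ldistr\<close>, with the roles of scalar and vector
  exchanged; it turns the terms containing the weighted mean into a single multiple of it.\<close>

lemma finsum_smult_const:
  assumes "finite A" "\<And>i. i \<in> A \<Longrightarrow> c i \<in> K" "v \<in> carrier M"
  shows "(\<Oplus>i\<in>A. c i \<odot> v) = (\<Sum>i\<in>A. c i) \<odot> v"
  using assms
proof (induction A rule: finite_induct)
  case (insert j A)
  then have "(\<lambda>i. c i \<odot> v) \<in> A \<rightarrow> carrier M"
    by auto
  then show ?case
    using insert by (simp add: smult_add_scalar)
qed simp

lemma nrm_finsum_le:
  assumes "finite A" "f \<in> A \<rightarrow> carrier M"
  shows "nrm (\<Oplus>i\<in>A. f i) \<le> (\<Sum>i\<in>A. nrm (f i))"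
  using assms
proof (induction A rule: finite_induct)
  case empty
  then show ?case using nrm_eq_zero_iff[of \<zero>] by simp
next
  case (insert j A)
  then have "f j \<in> carrier M" "f \<in> A \<rightarrow> carrier M"
    by auto
  with insert nrm_triangle[of "f j" "\<Oplus>i\<in>A. f i"] show ?case
    by simp
qed

section \<open>Recentring the covariance and bounding its norm\<close>

text \<open>Write \<open>T\<close> for the sum of the \<open>(p i * a i) \<odot> x i\<close> and
  \<open>b\<close> for the sum of the \<open>p i * a i\<close>. Expanding the right-hand side gives
  \<open>T\<close>, minus \<open>\<alpha> \<odot> s\<close>, minus
  \<open>(b - \<alpha>) \<odot> s\<close>, and the multiples of \<open>\<alpha>\<close> cancel.
  Total weight one is what makes the last coefficient \<open>b - \<alpha>\<close>.\<close>

lemma weighted_covariance_identity: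
  fixes p :: "'i \<Rightarrow> complex"
  assumes fin: "finite A" and p: "\<And>i. i \<in> A \<Longrightarrow> p i \<in> K" and sum: "(\<Sum>i\<in>A. p i) = 1"
    and a: "\<And>i. i \<in> A \<Longrightarrow> a i \<in> K" and x: "\<And>i. i \<in> A \<Longrightarrow> x i \<in> carrier M" and \<alpha>: "\<alpha> \<in> K"
  defines "s \<equiv> \<Oplus>i\<in>A. p i \<odot> x i"
  shows "(\<Oplus>i\<in>A. (p i * a i) \<odot> x i) \<ominus> (\<Sum>i\<in>A. p i * a i) \<odot> s
       = (\<Oplus>i\<in>A. (p i * (a i - \<alpha>)) \<odot> (x i \<ominus> s))"
proof -
  let ?T = "\<Oplus>i\<in>A. (p i * a i) \<odot> x i" and ?b = "\<Sum>i\<in>A. p i * a i"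
  have px: "(\<lambda>i. p i \<odot> x i) \<in> A \<rightarrow> carrier M"
    and pax: "(\<lambda>i. (p i * a i) \<odot> x i) \<in> A \<rightarrow> carrier M"
    using p a x by auto
  have s: "s \<in> carrier M" and T: "?T \<in> carrier M" and b: "?b \<in> K"
    unfolding s_def using px pax p a by (auto intro: M.finsum_closed)
  have "(\<Sum>i\<in>A. p i * (a i - \<alpha>)) = ?b - (\<Sum>i\<in>A. p i) * \<alpha>"
    by (simp add: algebra_simps sum_subtractf sum_distrib_left)
  then have w: "(\<Sum>i\<in>A. p i * (a i - \<alpha>)) = ?b - \<alpha>"
    by (simp add: sum)
  have "(\<Oplus>i\<in>A. (p i * (a i - \<alpha>)) \<odot> (x i \<ominus> s))
      = (\<Oplus>i\<in>A. ((p i * a i) \<odot> x i \<ominus> \<alpha> \<odot> (p i \<odot> x i)) \<ominus> (p i * (a i - \<alpha>)) \<odot> s)"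
  proof (rule M.finsum_cong')
    fix i assume i: "i \<in> A"
    \<comment> \<open>The factor \<open>\<alpha>\<close> is put in front so that it acts outermost
      and can later be pulled out of the sum, leaving \<open>s\<close>.\<close>
    have "(p i * (a i - \<alpha>)) \<odot> x i = (p i * a i - \<alpha> * p i) \<odot> x i"
      by (simp add: algebra_simps)
    also have "\<dots> = (p i * a i) \<odot> x i \<ominus> \<alpha> \<odot> (p i \<odot> x i)"
      using i p a x \<alpha> by (simp add: smult_diff_scalar smult_mult_scalar)
    finally show "(p i * (a i - \<alpha>)) \<odot> (x i \<ominus> s)
        = ((p i * a i) \<odot> x i \<ominus> \<alpha> \<odot> (p i \<odot> x i)) \<ominus> (p i * (a i - \<alpha>)) \<odot> s"
      using i p a x \<alpha> s by (simp add: smult_diff_vector)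
  qed (use p a x \<alpha> s in auto)
  also have "\<dots> = ((\<Oplus>i\<in>A. (p i * a i) \<odot> x i) \<ominus> (\<Oplus>i\<in>A. \<alpha> \<odot> (p i \<odot> x i)))
      \<ominus> (\<Oplus>i\<in>A. (p i * (a i - \<alpha>)) \<odot> s)"
    using fin p a x \<alpha> s by (subst finsum_diff, (force+)[3], subst finsum_diff, auto)
  also have "(\<Oplus>i\<in>A. \<alpha> \<odot> (p i \<odot> x i)) = \<alpha> \<odot> s"
    unfolding s_def using finsum_smult_ldistr[of A \<alpha> "\<lambda>i. p i \<odot> x i"] fin \<alpha> px by simp
  also have "(\<Oplus>i\<in>A. (p i * (a i - \<alpha>)) \<odot> s) = (?b - \<alpha>) \<odot> s"
    using finsum_smult_const[of A "\<lambda>i. p i * (a i - \<alpha>)" s] fin p a \<alpha> s w by simp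
  \<comment> \<open>Distributing \<open>?b - \<alpha>\<close> over \<open>s\<close> produces
    \<open>\<alpha> \<odot> s\<close> with both signs.\<close>
  also have "(?T \<ominus> \<alpha> \<odot> s) \<ominus> (?b - \<alpha>) \<odot> s = ?T \<ominus> ?b \<odot> s"
    using T b s \<alpha>
    by (simp add: smult_diff_scalar M.minus_eq M.minus_add M.a_ac M.r_neg1 M.r_neg2)
  finally show ?thesis by simp
qed

lemma nrm_weighted_covariance_le:
  fixes p :: "'i \<Rightarrow> real"
  assumes fin: "finite A" and pK: "\<And>i. i \<in> A \<Longrightarrow> complex_of_real (p i) \<in> K"
    and p: "\<And>i. i \<in> A \<Longrightarrow> 0 \<le> p i" and sum: "(\<Sum>i\<in>A. p i) = 1"
    and a: "\<And>i. i \<in> A \<Longrightarrow> a i \<in> K" and x: "\<And>i. i \<in> A \<Longrightarrow> x i \<in> carrier M" and \<alpha>: "\<alpha> \<in> K"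
    and R: "\<And>i. i \<in> A \<Longrightarrow> cmod (a i - \<alpha>) \<le> R"
  defines "s \<equiv> \<Oplus>i\<in>A. complex_of_real (p i) \<odot> x i"
  shows "nrm ((\<Oplus>i\<in>A. (complex_of_real (p i) * a i) \<odot> x i)
           \<ominus> (\<Sum>i\<in>A. complex_of_real (p i) * a i) \<odot> s)
       \<le> R * (\<Sum>i\<in>A. p i * nrm (x i \<ominus> s))"
proof -
  have s: "s \<in> carrier M"
    unfolding s_def using pK x by (auto intro: M.finsum_closed)
  \<comment> \<open>The weights are real here, while the identity asks for weights in
    \<open>K\<close>; the normalisation is carried over by \<open>of_real\<close>.\<close>
  have "(\<Sum>i\<in>A. complex_of_real (p i)) = 1"
    using sum by (metis of_real_1 of_real_sum)
  then have "nrm ((\<Oplus>i\<in>A. (complex_of_real (p i) * a i) \<odot> x i)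
           \<ominus> (\<Sum>i\<in>A. complex_of_real (p i) * a i) \<odot> s)
      = nrm (\<Oplus>i\<in>A. (complex_of_real (p i) * (a i - \<alpha>)) \<odot> (x i \<ominus> s))"
    unfolding s_def
    using weighted_covariance_identity[of A "\<lambda>i. complex_of_real (p i)" a x \<alpha>] fin pK a x \<alpha>
    by simp
  also have "\<dots> \<le> (\<Sum>i\<in>A. nrm ((complex_of_real (p i) * (a i - \<alpha>)) \<odot> (x i \<ominus> s)))"
    using fin pK a x \<alpha> s by (intro nrm_finsum_le) auto
  also have "\<dots> \<le> (\<Sum>i\<in>A. R * (p i * nrm (x i \<ominus> s)))"
  proof (rule sum_mono)
    fix i assume i: "i \<in> A"
    \<comment> \<open>Nonnegativity of \<open>p i\<close> serves twice: it makes the common factor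
      nonnegative here, and it gives \<open>p i\<close> as the modulus of the embedded weight
      below.\<close>
    have "cmod (a i - \<alpha>) * (p i * nrm (x i \<ominus> s)) \<le> R * (p i * nrm (x i \<ominus> s))"
      using i R p x s by (intro mult_right_mono mult_nonneg_nonneg nrm_nonneg) auto
    then show "nrm ((complex_of_real (p i) * (a i - \<alpha>)) \<odot> (x i \<ominus> s)) \<le> R * (p i * nrm (x i \<ominus> s))"
      using i pK p a x \<alpha> s by (simp add: nrm_smult norm_mult mult_ac)
  qed
  finally show ?thesis
    by (simp add: sum_distrib_left)
qed

end

section \<open>A copy of the scalar line inside the universe\<close>

text \<open>The extremal example must have its carrier in \<open>'u\<close>, so \<open>K\<close>, as
  a space over itself, is encoded there by \<open>f\<close>. Operations decode with
  \<open>inv_into UNIV f\<close>, compute in the complex numbers and encode again.\<close>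

definition transported_line :: "(complex \<Rightarrow> 'u) \<Rightarrow> complex set \<Rightarrow> (complex, 'u) module" where
  "transported_line f K = \<lparr>carrier = f ` K, mult = (\<lambda>u v. u), one = f 0, zero = f 0,
     add = (\<lambda>u v. f (inv_into UNIV f u + inv_into UNIV f v)),
     smult = (\<lambda>c v. f (c * inv_into UNIV f v))\<rparr>"

lemma transported_line_simps:
  assumes "inj f"
  shows "carrier (transported_line f K) = f ` K"
    and "\<zero>\<^bsub>transported_line f K\<^esub> = f 0"
    and "f z \<oplus>\<^bsub>transported_line f K\<^esub> f w = f (z + w)"
    and "c \<odot>\<^bsub>transported_line f K\<^esub> f z = f (c * z)"
  using assms by (simp_all add: transported_line_def)

text \<open>Every carrier element is some \<open>f z\<close>, so the axioms reduce to complex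
  arithmetic and properties of the modulus. Injectivity of \<open>f\<close> makes decoding
  exact.\<close>

lemma normed_linear_space_transported_line:
  assumes K: "K = \<real> \<or> K = UNIV" and f: "inj f"
  shows "normed_linear_space K (transported_line f K) (\<lambda>v. cmod (inv_into UNIV f v))"
proof -
  note simps = transported_line_simps[OF f]
  interpret F: field "scalar_field K"
    by (rule field_scalar_field[OF K])
  have "abelian_group (transported_line f K)"
  proof (rule abelian_groupI)
    fix v assume "v \<in> carrier (transported_line f K)"
    then obtain z where "z \<in> K" "v = f z"
      by (auto simp: simps)
    then show "\<exists>w\<in>carrier (transported_line f K).
        w \<oplus>\<^bsub>transported_line f K\<^esub> v = \<zero>\<^bsub>transported_line f K\<^esub>"
      using K by (intro bexI[of _ "f (- z)"]) (auto simp: simps)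
  qed (use K in \<open>auto simp: simps add_ac\<close>)
  then have "module (scalar_field K) (transported_line f K)"
    using F.cring_axioms K by (intro moduleI) (auto simp: simps scalar_field_def algebra_simps)
  \<comment> \<open>With the field and module structure in scope, \<open>unfold_locales\<close>
    leaves only the norm axioms.\<close>
  then interpret module "scalar_field K" "transported_line f K" .
  show ?thesis
    by unfold_locales
      (use f K in \<open>auto simp: simps norm_mult norm_triangle_ineq inj_eq\<close>)
qed

text \<open>Subtraction is derived from the abstract additive inverse, so it has no defining
  equation in terms of \<open>f\<close>. That inverse is found from its uniqueness, since
  \<open>f (- w)\<close> added to \<open>f w\<close> gives \<open>f 0\<close>.\<close>

lemma transported_line_minus:
  assumes K: "K = \<real> \<or> K = UNIV" and f: "inj f" and "z \<in> K" "w \<in> K"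
  shows "f z \<ominus>\<^bsub>transported_line f K\<^esub> f w = f (z - w)"
proof -
  interpret normed_linear_space K "transported_line f K" "\<lambda>v. cmod (inv_into UNIV f v)"
    by (rule normed_linear_space_transported_line[OF K f])
  have "\<ominus>\<^bsub>transported_line f K\<^esub> f w = f (- w)"
    using assms by (intro M.minus_equality) (auto simp: transported_line_simps[OF f])
  then show ?thesis
    by (simp add: M.minus_eq transported_line_simps[OF f])
qed

text \<open>\<open>f\<close> is additive from \<open>K\<close> to the line, so the weighted means of
  the example become ordinary complex sums.\<close>

lemma transported_line_finsum:
  assumes K: "K = \<real> \<or> K = UNIV" and f: "inj f" and "finite A" "\<And>i. i \<in> A \<Longrightarrow> z i \<in> K"
  shows "(\<Oplus>\<^bsub>transported_line f K\<^esub>i\<in>A. f (z i)) = f (\<Sum>i\<in>A. z i)"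
proof -
  interpret normed_linear_space K "transported_line f K" "\<lambda>v. cmod (inv_into UNIV f v)"
    by (rule normed_linear_space_transported_line[OF K f])
  show ?thesis
    using assms(3,4)
  proof (induction A rule: finite_induct)
    case empty
    then show ?case by (simp add: transported_line_simps[OF f])
  next
    case (insert j A)
    then have "(\<lambda>i. f (z i)) \<in> A \<rightarrow> carrier (transported_line f K)"
      by (auto simp: transported_line_simps[OF f])
    with insert show ?case
      by (simp add: transported_line_simps[OF f])
  qed
qed

section \<open>The bound in every space, and sharpness from two points\<close>

theorem theorem2:
  fixes K :: "complex set"
  assumes "K = \<real> \<or> K = UNIV"
  shows
    "(\<forall>(M :: (complex, 'u) module) nrm (n::nat) (a :: nat \<Rightarrow> complex) (p :: nat \<Rightarrow> real)
        (x :: nat \<Rightarrow> 'u) (\<alpha>::complex) (R::real).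
        normed_linear_space K M nrm \<longrightarrow> n \<ge> 1 \<longrightarrow>
        (\<forall>i\<in>{1..n}. a i \<in> K) \<longrightarrow>
        (\<forall>i\<in>{1..n}. p i \<ge> 0) \<longrightarrow> (\<Sum>i=1..n. p i) = 1 \<longrightarrow>
        (\<forall>i\<in>{1..n}. x i \<in> carrier M) \<longrightarrow>
        \<alpha> \<in> K \<longrightarrow> R > 0 \<longrightarrow> (\<forall>i\<in>{1..n}. cmod (a i - \<alpha>) \<le> R) \<longrightarrow>
        nrm ((\<Oplus>\<^bsub>M\<^esub>i\<in>{1..n}. (of_real (p i) * a i) \<odot>\<^bsub>M\<^esub> x i)
              \<ominus>\<^bsub>M\<^esub> (\<Sum>i=1..n. of_real (p i) * a i) \<odot>\<^bsub>M\<^esub> (\<Oplus>\<^bsub>M\<^esub>i\<in>{1..n}. of_real (p i) \<odot>\<^bsub>M\<^esub> x i))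
          \<le> R * (\<Sum>i=1..n. p i * nrm (x i \<ominus>\<^bsub>M\<^esub> (\<Oplus>\<^bsub>M\<^esub>j\<in>{1..n}. of_real (p j) \<odot>\<^bsub>M\<^esub> x j))))
     \<and>
     ((\<exists>f :: complex \<Rightarrow> 'u. inj f) \<longrightarrow>
      (\<forall>C::real. C > 0 \<longrightarrow>
        (\<forall>(M :: (complex, 'u) module) nrm (n::nat) (a :: nat \<Rightarrow> complex) (p :: nat \<Rightarrow> real)
          (x :: nat \<Rightarrow> 'u) (\<alpha>::complex) (R::real).
          normed_linear_space K M nrm \<longrightarrow> n \<ge> 1 \<longrightarrow>
          (\<forall>i\<in>{1..n}. a i \<in> K) \<longrightarrow>
          (\<forall>i\<in>{1..n}. p i \<ge> 0) \<longrightarrow> (\<Sum>i=1..n. p i) = 1 \<longrightarrow>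
          (\<forall>i\<in>{1..n}. x i \<in> carrier M) \<longrightarrow>
          \<alpha> \<in> K \<longrightarrow> R > 0 \<longrightarrow> (\<forall>i\<in>{1..n}. cmod (a i - \<alpha>) \<le> R) \<longrightarrow>
          nrm ((\<Oplus>\<^bsub>M\<^esub>i\<in>{1..n}. (of_real (p i) * a i) \<odot>\<^bsub>M\<^esub> x i)
                \<ominus>\<^bsub>M\<^esub> (\<Sum>i=1..n. of_real (p i) * a i) \<odot>\<^bsub>M\<^esub> (\<Oplus>\<^bsub>M\<^esub>i\<in>{1..n}. of_real (p i) \<odot>\<^bsub>M\<^esub> x i))
            \<le> (C * R) * (\<Sum>i=1..n. p i * nrm (x i \<ominus>\<^bsub>M\<^esub> (\<Oplus>\<^bsub>M\<^esub>j\<in>{1..n}. of_real (p j) \<odot>\<^bsub>M\<^esub> x j))))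
        \<longrightarrow> C \<ge> 1))"
proof (intro conjI allI impI, goal_cases)
  case (1 M nrm n a p x \<alpha> R)
  then interpret normed_linear_space K M nrm
    by simp
  \<comment> \<open>Both choices of \<open>K\<close> contain the reals, so the weights are
    scalars.\<close>
  have "complex_of_real r \<in> K" for r
    using assms by auto
  then show ?case
    using 1 by (intro nrm_weighted_covariance_le) auto
next
  case (2 C)
  then obtain f :: "complex \<Rightarrow> 'u" where f: "inj f"
    by blast
  \<comment> \<open>Indices start at 1, so the two values used are \<open>z 1 = 1\<close> and
    \<open>z 2 = - 1\<close>. They serve as the scalars and, encoded by \<open>f\<close>, as the
    vectors.\<close>
  define z :: "nat \<Rightarrow> complex" where "z = (\<lambda>i. - 1)(1 := 1)"
  let ?M = "transported_line f K" and ?p = "\<lambda>i::nat. 1/2 :: real"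
  let ?s = "\<Oplus>\<^bsub>?M\<^esub>i\<in>{1..2}. complex_of_real (?p i) \<odot>\<^bsub>?M\<^esub> f (z i)"
  have I: "{1..2::nat} = {1, 2}"
    by auto
  have z: "z i \<in> K" and half: "c \<in> K \<Longrightarrow> c / 2 \<in> K" for i c
    using assms by (auto simp: z_def)
  have K01: "0 \<in> K" "1 \<in> K"
    using assms by auto
  note simps = transported_line_simps[OF f] and fin = transported_line_finsum[OF assms f]
    and minus = transported_line_minus[OF assms f]
  \<comment> \<open>Equal weights make the mean of 1 and -1 vanish, for scalars and vectors
    alike.\<close>
  have s: "?s = f 0"
    using fin[of "{1, 2}" "\<lambda>i. z i / 2"] z half unfolding I by (simp add: simps) (simp add: z_def)
  \<comment> \<open>Each product \<open>z i * z i\<close> is 1, so their mean is 1.\<close>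
  have T: "(\<Oplus>\<^bsub>?M\<^esub>i\<in>{1..2}. (complex_of_real (?p i) * z i) \<odot>\<^bsub>?M\<^esub> f (z i)) = f 1"
    using fin[of "{1, 2}" "\<lambda>i. z i * z i / 2"] K01 half unfolding I
    by (simp add: simps) (simp add: z_def)
  \<comment> \<open>The assumed inequality with constant \<open>C\<close> is applied with centre 0
    and radius 1, which is admissible because both scalars have modulus 1.\<close>
  have "cmod (inv_into UNIV f ((\<Oplus>\<^bsub>?M\<^esub>i\<in>{1..2}. (complex_of_real (?p i) * z i) \<odot>\<^bsub>?M\<^esub> f (z i))
          \<ominus>\<^bsub>?M\<^esub> (\<Sum>i=1..2. complex_of_real (?p i) * z i) \<odot>\<^bsub>?M\<^esub> ?s))
      \<le> (C * 1) * (\<Sum>i=1..2. ?p i * cmod (inv_into UNIV f (f (z i) \<ominus>\<^bsub>?M\<^esub> ?s)))"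
    using z K01 2(3)[rule_format, of ?M "\<lambda>v. cmod (inv_into UNIV f v)" 2 z ?p "\<lambda>i. f (z i)" 0 1]
      normed_linear_space_transported_line[OF assms f]
    by (simp add: simps z_def)
  \<comment> \<open>The left side is the modulus of 1. On the right both deviations from the mean
    have norm 1 and weight one half, so what remains is \<open>C\<close>.\<close>
  then show ?case
    unfolding s T unfolding I using f K01 z by (simp add: simps minus) (simp add: z_def)
qed

end
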